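(* For integers $n\ge 1$ let $L_1(n)=2^{2n}+2^n+1$. Let $k\ge 0$, $k_1\ge 0$, $k_2\ge 0$ be integers and let $t_1\ge 1$, $t_2\ge 1$ be odd integers with $t_1\not\equiv 0 \pmod 3$ and $t_2\not\equiv 0\pmod 3$. Then: (1) $\gcd\bigl(L_1(3^k t_1),L_1(3^k t_2)\bigr)=L_1\bigl(3^k\gcd(t_1,t_2)\bigr)$; (2) if $k_1\ne k_2$, then $\gcd\bigl(L_1(3^{k_1}t_1),L_1(3^{k_2}t_2)\bigr)=1$.
   Context: $\gcd(a,b)$ denotes the (positive) greatest common divisor of positive integers $a,b$. *)

theory Defs
  imports "HOL-Number_Theory.Cong"
begin

definition L1 :: "nat \<Rightarrow> nat" where
  "L1 n = 2 ^ (2 * n) + 2 ^ n + 1"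

end

theory Submission
  imports Defs "HOL-Number_Theory.Pocklington"
begin

text \<open>
  Since \<open>(2^n - 1) L1 n = 2^(3n) - 1\<close>, a divisor \<open>m\<close> of \<open>L1 n\<close> satisfies \<open>2^(3n) = 1\<close> modulo \<open>m\<close>,
  and for such \<open>m\<close> the residue of \<open>L1 (n a)\<close> is that of \<open>L1 n\<close> whenever 3 does not divide \<open>a\<close>.
  A common divisor of \<open>L1 (3^k t1)\<close> and \<open>L1 (3^k t2)\<close> hence satisfies the congruence for
  \<open>n = 3^k gcd t1 t2\<close>, which gives part (1). If \<open>k1 < k2\<close>, a common divisor \<open>m\<close> even satisfies
  \<open>2^(3^k2 t2) = 1\<close> modulo \<open>m\<close>, so \<open>m\<close> divides \<open>1 + 1 + 1 = 3\<close>, but \<open>L1 n\<close> is coprime to 3 for odd \<open>n\<close>.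
\<close>

text \<open>The exponents that send \<open>x\<close> to 1 modulo \<open>m\<close> are exactly the
  multiples of \<open>ord m x\<close>.\<close>

lemma cong_1_power_gcd:
  fixes x m i j :: nat
  assumes "[x ^ i = 1] (mod m)" and "[x ^ j = 1] (mod m)"
  shows "[x ^ gcd i j = 1] (mod m)"
  using assms by (simp only: ord_divides gcd_greatest_iff)

lemma L1_dvd_imp_cong_1:
  assumes "m dvd L1 n"
  shows "[2 ^ (3 * n) = 1] (mod m)"
proof -
  \<comment> \<open>The factorization of \<open>2 ^ (3 * n) - 1\<close>, rearranged to avoid
    subtraction on naturals.\<close>
  have "2 ^ (3 * n) + L1 n = 1 + 2 ^ n * L1 n"
    by (simp add: L1_def mult.commute[of _ n] power_mult power2_eq_square power3_eq_cube algebra_simps)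
  moreover have "[2 ^ (3 * n) + L1 n = 2 ^ (3 * n) + 0] (mod m)"
    using assms by (intro cong_add) (auto simp: cong_0_iff)
  moreover have "[1 + 2 ^ n * L1 n = 1 + 0] (mod m)"
    using assms by (intro cong_add) (auto simp: cong_0_iff)
  ultimately show ?thesis
    by (metis add_0_right cong_sym cong_trans)
qed

text \<open>Modulo \<open>m\<close>, \<open>A = 2 ^ n\<close> is a cube root of unity, so
  \<open>A ^ a\<close> is \<open>A\<close> or \<open>A ^ 2\<close>; squaring merely swaps these two
  terms of \<open>A ^ 2 + A + 1\<close>.\<close>

lemma L1_mult_cong:
  assumes cube: "[2 ^ (3 * n) = 1] (mod m)" and "\<not> 3 dvd a"
  shows "[L1 (n * a) = L1 n] (mod m)"
proof -
  define A :: nat where "A = 2 ^ n"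
  define q where "q = a div 3"
  have L1: "L1 (n * b) = (A ^ b)^2 + A ^ b + 1" for b
    by (simp add: L1_def A_def mult_ac flip: power_mult)
  have A3: "[A ^ 3 = 1] (mod m)"
    using cube by (simp add: A_def mult.commute flip: power_mult)
  have red: "[A ^ (3 * q + r) = A ^ r] (mod m)" for r
    using cong_mult[OF cong_pow[OF A3, of q] cong_refl[of "A ^ r"]]
    by (simp add: power_add power_mult)
  from assms(2) have "a = 3 * q + 1 \<or> a = 3 * q + 2"
    unfolding q_def by presburger
  then consider "a = 3 * q + 1" | "a = 3 * q + 2"
    by blast
  then show ?thesis
  proof cases
    case 1
    with red[of 1] have "[A ^ a = A ^ 1] (mod m)" by simp
    then have "[L1 (n * a) = L1 (n * 1)] (mod m)"
      unfolding L1 by (intro cong_add cong_pow cong_refl)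
    then show ?thesis by simp
  next
    case 2
    with red[of 2] have "[A ^ a = A ^ 2] (mod m)" by simp
    then have "[L1 (n * a) = (A ^ 2)^2 + A ^ 2 + 1] (mod m)"
      unfolding L1 by (intro cong_add cong_pow cong_refl)
    also have "[(A ^ 2)^2 + A ^ 2 + 1 = A + A ^ 2 + 1] (mod m)"
      using cong_mult[OF A3 cong_refl[of A]]
      by (intro cong_add cong_refl) (simp add: power2_eq_square power3_eq_cube mult_ac)
    also have "A + A ^ 2 + 1 = L1 n"
      using L1[of 1] by simp
    finally show ?thesis .
  qed
qed

text \<open>An odd power of 2 is 2 modulo 3, so \<open>L1 n\<close> is congruent to 7, hence to
  1.\<close>

lemma coprime_L1_3:
  assumes "odd n"
  shows "coprime (L1 n) 3"
proof -
  obtain j where n: "n = 2 * j + 1"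
    using assms by (elim oddE)
  have "[(2 ^ 2) ^ j = (1 :: nat) ^ j] (mod 3)"
    by (intro cong_pow) (simp add: cong_def)
  then have "[2 ^ n = (2 :: nat)] (mod 3)"
    using cong_scalar_right[of "(2 ^ 2) ^ j" 1 3 "2 :: nat"] by (simp add: n power_mult mult.commute[of _ "2 :: nat"])
  then have "[L1 n = 2 ^ 2 + 2 + 1] (mod 3)"
    unfolding L1_def mult.commute[of 2] power_mult by (intro cong_add cong_pow cong_refl)
  then have "[L1 n = 1] (mod 3)"
    by (simp add: cong_def)
  then show ?thesis
    using cong_imp_coprime cong_sym coprime_1_left by blast
qed

lemma gcd_L1_mult:
  assumes "\<not> 3 dvd t1" and "\<not> 3 dvd t2"
  shows "gcd (L1 (n * t1)) (L1 (n * t2)) = L1 (n * gcd t1 t2)"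
proof (rule dvd_antisym)
  let ?d = "gcd t1 t2" and ?g = "gcd (L1 (n * t1)) (L1 (n * t2))"
  obtain a b where t: "t1 = ?d * a" "t2 = ?d * b"
    by (meson dvdE gcd_dvd1 gcd_dvd2)
  have ab: "\<not> 3 dvd a" "\<not> 3 dvd b"
    using assms t by (metis dvd_mult)+
  have L1_t: "[L1 (n * t1) = L1 (n * ?d)] (mod m)" "[L1 (n * t2) = L1 (n * ?d)] (mod m)"
    if "[2 ^ (3 * (n * ?d)) = 1] (mod m)" for m
    using L1_mult_cong[OF that ab(1)] L1_mult_cong[OF that ab(2)] t
    by (metis mult.assoc)+
  have "[2 ^ gcd (3 * (n * t1)) (3 * (n * t2)) = 1] (mod ?g)"
    by (intro cong_1_power_gcd L1_dvd_imp_cong_1) auto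
  then have "[2 ^ (3 * (n * ?d)) = 1] (mod ?g)"
    by (simp add: gcd_mult_distrib_nat)
  from L1_t(1)[OF this] show "?g dvd L1 (n * ?d)"
    using cong_dvd_iff gcd_dvd1 by blast
  \<comment> \<open>Here the modulus is \<open>L1 (n * ?d)\<close> itself, so both values are
    congruent to 0.\<close>
  show "L1 (n * ?d) dvd ?g"
    using L1_t[OF L1_dvd_imp_cong_1[OF dvd_refl]] by (auto simp: cong_dvd_iff)
qed

lemma coprime_L1_of_3_power_less:
  assumes "odd t2" and "\<not> 3 dvd t1" and "k1 < k2"
  shows "coprime (L1 (3 ^ k1 * t1)) (L1 (3 ^ k2 * t2))"
proof (rule coprimeI)
  fix m
  assume m: "m dvd L1 (3 ^ k1 * t1)" "m dvd L1 (3 ^ k2 * t2)"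
  let ?n = "3 ^ k2 * t2"
  obtain j where k2: "k2 = Suc k1 + j"
    using assms(3) less_iff_Suc_add by auto
  \<comment> \<open>As \<open>k1 < k2\<close>, the exponent \<open>3 * (3 ^ k1 * t1)\<close>
    obtained from \<open>m(1)\<close> divides \<open>?n * t1\<close>.\<close>
  have "?n * t1 = 3 * (3 ^ k1 * t1) * (3 ^ j * t2)"
    by (simp add: k2 power_add)
  then have "[2 ^ (?n * t1) = 1] (mod m)"
    using cong_pow[OF L1_dvd_imp_cong_1[OF m(1)], of "3 ^ j * t2"] by (simp only: power_mult power_one)
  then have "[2 ^ gcd (?n * 3) (?n * t1) = 1] (mod m)"
    using L1_dvd_imp_cong_1[OF m(2)] by (intro cong_1_power_gcd) (simp_all add: mult.commute)
  \<comment> \<open>Coprimality of 3 and \<open>t1\<close> removes the extra factor 3 from the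
    exponent.\<close>
  moreover have "gcd (?n * 3) (?n * t1) = ?n"
    using assms(2) prime_imp_coprime[of 3 t1] by (simp flip: gcd_mult_distrib_nat)
  ultimately have "[2 ^ ?n = 1] (mod m)" by simp
  then have "[L1 ?n = 1 ^ 2 + 1 + 1] (mod m)"
    unfolding L1_def mult.commute[of 2] power_mult[of _ _ 2] by (intro cong_add cong_pow cong_refl)
  with m(2) have "m dvd 3"
    by (simp add: cong_dvd_iff numeral_3_eq_3)
  moreover have "coprime (L1 ?n) 3"
    using assms(1) by (intro coprime_L1_3) simp
  ultimately show "is_unit m"
    using m(2) coprime_common_divisor by blast
qed

theorem theorem1:
  fixes k k1 k2 t1 t2 :: nat
  assumes "t1 \<ge> 1" and "t2 \<ge> 1"
    and "odd t1" and "odd t2"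
    and "\<not> [t1 = 0] (mod 3)" and "\<not> [t2 = 0] (mod 3)"
  shows "gcd (L1 (3 ^ k * t1)) (L1 (3 ^ k * t2)) = L1 (3 ^ k * gcd t1 t2)
    \<and> (k1 \<noteq> k2 \<longrightarrow> gcd (L1 (3 ^ k1 * t1)) (L1 (3 ^ k2 * t2)) = 1)"
proof -
  have t: "\<not> 3 dvd t1" "\<not> 3 dvd t2"
    using assms by (auto simp: cong_0_iff)
  have "coprime (L1 (3 ^ k1 * t1)) (L1 (3 ^ k2 * t2))" if "k1 \<noteq> k2"
    using that
  proof (cases k1 k2 rule: linorder_cases)
    case less
    then show ?thesis
      using coprime_L1_of_3_power_less assms t by blast
  next
    case greater
    then show ?thesis
      using coprime_L1_of_3_power_less assms t coprime_commute by blast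
  qed auto
  then show ?thesis
    using gcd_L1_mult[OF t] by (auto simp: coprime_iff_gcd_eq_1)
qed

end
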